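(* Let $1\le p<\infty$ and $-1<\alpha<\infty$. Let $M\neq\{0\}$ be any invariant subspace for the shift operator $M_z$ on the Bergman space $A^p_\alpha(\mathbb{D})$. Then $M$ contains a nonempty subset that lies in $A^p_\alpha(\mathbb{D})\setminus H^p(\mathbb{D})$; that is, $M\cap\big(A^p_\alpha(\mathbb{D})\setminus H^p(\mathbb{D})\big)\neq\emptyset$.
   Context: $\mathbb{D}$ is the open unit disk in the complex plane. For $1\le p<\infty$, $H^p(\mathbb{D})$ denotes the classical Hardy space of analytic functions on $\mathbb{D}$. For $1\le p<\infty$ and $-1<\alpha<\infty$, the (weighted) Bergman space $A^p_\alpha(\mathbb{D})$ is the space of all analytic functions $f$ on $\mathbb{D}$ with $\int_{\mathbb{D}}|f(z)|^p\,dA_\alpha(z)<\infty$, with the norm $\|f\|_{A^p_\alpha(\mathbb{D})}=\left(\int_{\mathbb{D}}|f(z)|^p\,dA_\alpha(z)\right)^{1/p}$, where $dA_\alpha(z)=\frac{\alpha+1}{\pi}(1-|z|^2)^\alpha\,dA(z)$ and $dA$ is planar Lebesgue (area) measure on $\mathbb{D}$, so that $\mathbb{D}$ has $dA$-measure $\pi$. As sets of functions, $H^p(\mathbb{D})\subset A^p_\alpha(\mathbb{D})$. The shift operator $M_z$ on $A^p_\alpha(\mathbb{D})$ is defined by $(M_zf)(z)=zf(z)$. An invariant subspace for $M_z$ on $A^p_\alpha(\mathbb{D})$ is a linear subspace $M$ of $A^p_\alpha(\mathbb{D})$ that is closed in the norm of $A^p_\alpha(\mathbb{D})$ and satisfies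 $zM\subset M$. *)

theory Defs
  imports "HOL-Analysis.Analysis" "HOL-Library.Function_Algebras"
begin

abbreviation unit_disk :: "complex set"
  where "unit_disk \<equiv> ball 0 1"

(* A function on the disk is represented by its extension by 0 to the whole plane, so that
   functions agreeing on the disk are equal and pointwise operations are the vector space
   operations. *)
definition analytic_fns :: "(complex \<Rightarrow> complex) set"
  where "analytic_fns = {f. f holomorphic_on unit_disk \<and> (\<forall>z. z \<notin> unit_disk \<longrightarrow> f z = 0)}"

definition cscale :: "complex \<Rightarrow> (complex \<Rightarrow> complex) \<Rightarrow> complex \<Rightarrow> complex"
  where "cscale c f = (\<lambda>z. c * f z)"

interpretation cfun: vector_space cscale
  by unfold_locales (auto simp: cscale_def fun_eq_iff algebra_simps)

definition weighted_area :: "real \<Rightarrow> complex measure"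
  where "weighted_area \<alpha> = density (restrict_space lborel unit_disk)
           (\<lambda>z. ennreal ((\<alpha> + 1) / pi * (1 - (cmod z)\<^sup>2) powr \<alpha>))"

definition bergman_space :: "real \<Rightarrow> real \<Rightarrow> (complex \<Rightarrow> complex) set"
  where "bergman_space p \<alpha> =
           {f \<in> analytic_fns. integrable (weighted_area \<alpha>) (\<lambda>z. cmod (f z) powr p)}"

definition bergman_norm :: "real \<Rightarrow> real \<Rightarrow> (complex \<Rightarrow> complex) \<Rightarrow> real"
  where "bergman_norm p \<alpha> f = (LINT z|weighted_area \<alpha>. cmod (f z) powr p) powr (1 / p)"

definition hardy_mean :: "real \<Rightarrow> real \<Rightarrow> (complex \<Rightarrow> complex) \<Rightarrow> real"
  where "hardy_mean p r f =
           (1 / (2 * pi) * (LINT t:{0..2 * pi}|lborel. cmod (f (of_real r * cis t)) powr p)) powr (1 / p)"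

definition hardy_space :: "real \<Rightarrow> (complex \<Rightarrow> complex) set"
  where "hardy_space p =
           {f \<in> analytic_fns. bdd_above ((\<lambda>r. hardy_mean p r f) ` {0..<1})}"

definition shift_op :: "(complex \<Rightarrow> complex) \<Rightarrow> complex \<Rightarrow> complex"
  where "shift_op f = (\<lambda>z. z * f z)"

definition bergman_closed :: "real \<Rightarrow> real \<Rightarrow> (complex \<Rightarrow> complex) set \<Rightarrow> bool"
  where "bergman_closed p \<alpha> M \<longleftrightarrow>
           (\<forall>F f. (\<forall>n. F n \<in> M) \<and> f \<in> bergman_space p \<alpha> \<and>
                  (\<lambda>n. bergman_norm p \<alpha> (F n - f)) \<longlonglongrightarrow> 0 \<longrightarrow> f \<in> M)"

definition invariant_subspace :: "real \<Rightarrow> real \<Rightarrow> (complex \<Rightarrow> complex) set \<Rightarrow> bool"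
  where "invariant_subspace p \<alpha> M \<longleftrightarrow>
           M \<subseteq> bergman_space p \<alpha> \<and> cfun.subspace M \<and> bergman_closed p \<alpha> M \<and> shift_op ` M \<subseteq> M"

end

theory Submission
  imports Defs "HOL-Complex_Analysis.Cauchy_Integral_Formula"
begin

text \<open>
  Taylor coefficients of a Hardy space function are bounded, by Cauchy's formula. So let \<open>f\<close> be a
  nonzero element of \<open>M\<close> with bounded coefficients and first nonzero coefficient \<open>a\<close> at index \<open>m\<close>,
  and multiply it by a lacunary series \<open>h z = (\<Sum>k. R ^ k * z ^ \<nu> k)\<close>. If \<open>R\<close> is large, the coefficient
  of \<open>h * f\<close> at \<open>\<nu> k + m\<close> is at least \<open>R ^ k * \<bar>a\<bar> / 2\<close>, so \<open>h * f\<close> is not in the Hardy space. Since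
  \<open>z ^ n * f\<close> tends to 0 in the Bergman norm, the exponents \<open>\<nu> k\<close> can be chosen to grow so fast that
  the partial sums of \<open>h\<close> times \<open>f\<close>, which lie in \<open>M\<close>, converge to \<open>h * f\<close> in that norm.
\<close>

section \<open>Taylor coefficients of Hardy space functions\<close>

text \<open>Cauchy's formula on the circle of radius \<open>r\<close> bounds the coefficient by the
  mean of \<open>cmod g\<close>. The crude estimate \<open>x \<le> 1 + x powr p\<close> then brings
  in the \<open>p\<close>-th power in place of Hoelder's inequality; it is the source of the summand
  1.\<close>

lemma coeff_le_hardy_mean:
  fixes g :: "complex \<Rightarrow> complex"
  assumes p: "1 \<le> p" and hol: "g holomorphic_on unit_disk" and G: "g has_fps_expansion G"
    and r: "0 < r" "r < 1"
  shows "cmod (fps_nth G n) * r ^ n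
           \<le> 1 + 1 / (2 * pi) * (LINT t:{0..2 * pi}|lborel. cmod (g (of_real r * cis t)) powr p)"
proof -
  let ?h = "\<lambda>t::real. cmod (g (of_real r * cis t)) powr p"
  \<comment> \<open>The integrand of Cauchy's formula pulled back to the angle \<open>t\<close>; the
    trailing factors are the derivative of \<open>of_real r * cis t\<close>.\<close>
  let ?c = "\<lambda>t::real. g (of_real r * cis t) / (of_real r * cis t) ^ Suc n * of_real r * \<i> * cis t"
  have sub: "cball (0::complex) r \<subseteq> unit_disk" using r by auto
  have cont: "continuous_on {0..2*pi} (\<lambda>t. g (of_real r * cis t))"
    by (rule continuous_on_compose2[OF holomorphic_on_imp_continuous_on[OF hol]])
       (use r in \<open>auto intro!: continuous_intros simp: norm_mult\<close>)
  have conth: "continuous_on {0..2*pi} ?h"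
    using p by (intro continuous_on_powr' continuous_intros cont) auto
  have int: "set_integrable lborel {0..2*pi} ?h"
    by (rule borel_integrable_atLeastAtMost'[OF conth])
  have I: "(LINT t:{0..2 * pi}|lborel. ?h t) = integral {0..2*pi} ?h"
    by (rule set_borel_integral_eq_integral(2)[OF int])
  have h_int: "?h integrable_on {0..2*pi}"
    by (rule integrable_continuous_interval[OF conth])
  have "((\<lambda>u. g u / (u - 0) ^ Suc n) has_contour_integral
           (2 * pi * \<i> / fact n * (deriv ^^ n) g 0)) (circlepath 0 r)"
    by (rule Cauchy_has_contour_integral_higher_derivative_circlepath)
       (use r sub hol in \<open>auto intro!: holomorphic_on_imp_continuous_on intro: holomorphic_on_subset\<close>)
  also have "(2 * pi * \<i> / fact n * (deriv ^^ n) g 0) = 2 * pi * \<i> * fps_nth G n"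
    by (simp add: fps_nth_fps_expansion[OF G])
  finally have C: "(?c has_integral (2 * pi * \<i> * fps_nth G n)) {0..2*pi}"
    unfolding circlepath_def by (subst (asm) has_contour_integral_part_circlepath_iff) auto
  have bound: "cmod (?c t) \<le> (1 + ?h t) / r ^ n" for t
  proof -
    have "x \<le> 1 + x powr p" if "0 \<le> x" for x :: real
    proof (cases "x \<le> 1")
      case False
      then show ?thesis using powr_mono[of 1 p x] p by simp
    qed (use powr_ge_zero[of x p] in linarith)
    then have "cmod (g (of_real r * cis t)) \<le> 1 + ?h t" by simp
    moreover have "cmod (?c t) = cmod (g (of_real r * cis t)) / r ^ n"
      using r by (simp add: norm_mult norm_divide norm_power)
    ultimately show ?thesis using r by (simp add: divide_right_mono)
  qed
  have "cmod (2 * pi * \<i> * fps_nth G n) = cmod (integral {0..2*pi} ?c)"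
    using C by (simp add: integral_unique)
  also have "\<dots> \<le> integral {0..2*pi} (\<lambda>t. (1 + ?h t) / r ^ n)"
    using C h_int bound
    by (intro integral_norm_bound_integral integrable_on_divide integrable_add) auto
  also have "\<dots> = (2 * pi + integral {0..2*pi} ?h) / r ^ n"
    using integral_add[OF integrable_const_ivl[of 1] h_int] by simp
  finally show ?thesis
    unfolding I using r by (simp add: norm_mult field_simps)
qed

lemma hardy_space_coeff_bounded:
  assumes p: "1 \<le> p" and g: "g \<in> hardy_space p" and G: "g has_fps_expansion G"
  shows "\<exists>B. \<forall>n. cmod (fps_nth G n) \<le> B"
proof -
  from g have hol: "g holomorphic_on unit_disk"
    and "bdd_above ((\<lambda>r. hardy_mean p r g) ` {0..<1})"
    by (auto simp: hardy_space_def analytic_fns_def)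
  then obtain K where K: "\<And>r. 0 \<le> r \<Longrightarrow> r < 1 \<Longrightarrow> hardy_mean p r g \<le> K"
    by (force simp: bdd_above_def)
  have "cmod (fps_nth G n) \<le> 1 + K powr p" for n
  proof -
    have "cmod (fps_nth G n) * r ^ n \<le> 1 + K powr p" if r: "0 < r" "r < 1" for r
    proof -
      let ?J = "1 / (2 * pi) * (LINT t:{0..2 * pi}|lborel. cmod (g (of_real r * cis t)) powr p)"
      have J: "0 \<le> ?J"
        unfolding set_lebesgue_integral_def
        by (intro mult_nonneg_nonneg Bochner_Integration.integral_nonneg) auto
      have "?J = (?J powr (1 / p)) powr p"
        using p powr_one[OF J] by (simp only: powr_powr) simp
      also have "\<dots> \<le> K powr p"
        using K[of r] r p by (intro powr_mono2) (auto simp: hardy_mean_def)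
      finally show ?thesis
        using coeff_le_hardy_mean[OF p hol G r, of n] by linarith
    qed
    \<comment> \<open>The bound is the same for all \<open>r\<close>, so letting \<open>r\<close>
      tend to 1 with \<open>n\<close> fixed removes the factor \<open>r ^ n\<close>.\<close>
    then have "\<forall>\<^sub>F r in at_left 1. cmod (fps_nth G n) * r ^ n \<le> 1 + K powr p"
      by (auto simp: eventually_at_left_field intro!: exI[of _ 0])
    moreover have "((\<lambda>r. cmod (fps_nth G n) * r ^ n) \<longlongrightarrow> cmod (fps_nth G n) * 1 ^ n) (at_left (1::real))"
      by (intro tendsto_intros)
    ultimately show ?thesis
      using tendsto_upperbound[of _ "cmod (fps_nth G n) * 1 ^ n" "at_left (1::real)"] by simp
  qed
  then show ?thesis by blast
qed

section \<open>Lacunary power series and estimates for series\<close>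

text \<open>In the Cauchy product, exponents above \<open>\<nu> k\<close> meet only coefficients of
  \<open>F\<close> below index \<open>m\<close>, which vanish. The exponent \<open>\<nu> k\<close>
  gives the main term, and the exponents \<open>\<nu> j\<close> with \<open>j < k\<close> give at
  most a geometric sum times \<open>B\<close>.\<close>

lemma lacunary_product_coeff_ge:
  fixes F H :: "complex fps" and \<nu> :: "nat \<Rightarrow> nat" and R :: real
  assumes F: "\<And>l. l < m \<Longrightarrow> fps_nth F l = 0" "\<And>l. cmod (fps_nth F l) \<le> B"
    and \<nu>: "strict_mono \<nu>" and R: "1 < R"
    and H: "\<And>j. fps_nth H (\<nu> j) = of_real (R ^ j)" "\<And>i. i \<notin> range \<nu> \<Longrightarrow> fps_nth H i = 0"
  shows "cmod (fps_nth (H * F) (\<nu> k + m)) \<ge> R ^ k * (cmod (fps_nth F m) - B / (R - 1))"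
proof -
  have B: "0 \<le> B" using F(2)[of 0] norm_ge_zero[of "fps_nth F 0"] by linarith
  let ?t = "\<lambda>i. fps_nth H i * fps_nth F (\<nu> k + m - i)"
  have "fps_nth (H * F) (\<nu> k + m) = sum ?t {0..\<nu> k + m}"
    by (simp add: fps_mult_nth)
  also have "\<dots> = sum ?t {0..\<nu> k}"
    by (rule sum.mono_neutral_right) (auto intro!: F(1))
  also have "\<dots> = sum ?t {..<\<nu> k} + of_real (R ^ k) * fps_nth F m"
    by (simp add: atLeast0AtMost lessThan_Suc_atMost[symmetric] H)
  finally have eq: "fps_nth (H * F) (\<nu> k + m) = sum ?t {..<\<nu> k} + of_real (R ^ k) * fps_nth F m" .
  have "cmod (sum ?t {..<\<nu> k}) \<le> (\<Sum>i<\<nu> k. cmod (fps_nth H i) * B)"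
    by (intro sum_norm_le) (simp add: norm_mult mult_left_mono F(2))
  also have "\<dots> = (\<Sum>i\<in>\<nu> ` {..<k}. cmod (fps_nth H i) * B)"
  proof (rule sum.mono_neutral_right)
    have "i \<notin> range \<nu>" if "i < \<nu> k" "i \<notin> \<nu> ` {..<k}" for i
      using that \<nu> by (auto simp: strict_mono_less)
    then show "\<forall>i\<in>{..<\<nu> k} - \<nu> ` {..<k}. cmod (fps_nth H i) * B = 0"
      by (simp add: H(2))
  qed (use \<nu> in \<open>auto simp: strict_mono_less\<close>)
  also have "\<dots> = (\<Sum>j<k. R ^ j) * B"
    using \<nu> R by (subst sum.reindex) (auto simp: strict_mono_imp_inj_on H norm_power sum_distrib_right)
  also have "\<dots> \<le> R ^ k / (R - 1) * B"
    using R B by (intro mult_right_mono) (auto simp: geometric_sum divide_right_mono)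
  finally have "cmod (sum ?t {..<\<nu> k}) \<le> R ^ k / (R - 1) * B" .
  moreover have "cmod (fps_nth (H * F) (\<nu> k + m)) \<ge> cmod (of_real (R ^ k) * fps_nth F m) - cmod (sum ?t {..<\<nu> k})"
    unfolding eq by (subst add.commute) (rule norm_diff_ineq)
  ultimately show ?thesis
    using R by (simp add: norm_mult norm_power algebra_simps)
qed

text \<open>Quadratic growth of the exponents beats every geometric factor: the terms are at most
  \<open>(C * r ^ k) ^ k\<close>, and \<open>C * r ^ k\<close> tends to 0.\<close>

lemma summable_power_times_power_square:
  fixes C r :: real
  assumes "0 \<le> C" "0 \<le> r" "r < 1" and \<nu>: "\<And>k. k\<^sup>2 \<le> \<nu> k"
  shows "summable (\<lambda>k. C ^ k * r ^ \<nu> k)"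
proof -
  have "(\<lambda>k. C * r ^ k) \<longlonglongrightarrow> C * 0"
    using assms by (intro tendsto_intros LIMSEQ_realpow_zero)
  then have "\<forall>\<^sub>F k in sequentially. C * r ^ k < 1 / 2"
    by (intro order_tendstoD) auto
  then have "\<forall>\<^sub>F k in sequentially. norm (C ^ k * r ^ \<nu> k) \<le> (1 / 2) ^ k"
  proof eventually_elim
    case (elim k)
    have "C ^ k * r ^ \<nu> k \<le> C ^ k * r ^ k\<^sup>2"
      using assms by (intro mult_left_mono power_decreasing) auto
    also have "\<dots> = (C * r ^ k) ^ k"
      by (simp add: power_mult_distrib power2_eq_square power_mult)
    also have "\<dots> \<le> (1 / 2) ^ k"
      using elim assms by (intro power_mono) auto
    finally show ?case using assms by simp
  qed
  then show ?thesis
    by (rule summable_comparison_test_ev) (simp add: summable_geometric)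
qed

text \<open>Turns the lacunary series into a formal power series, so that the coefficients of its
  product with \<open>f\<close> become accessible. Reindexing along \<open>\<nu>\<close> only
  inserts zero terms, so summability at each radius below 1 carries over.\<close>

lemma lacunary_series:
  fixes R :: real and \<nu> :: "nat \<Rightarrow> nat"
  assumes \<nu>: "strict_mono \<nu>" and summable: "\<And>r. 0 \<le> r \<Longrightarrow> r < 1 \<Longrightarrow> summable (\<lambda>k. R ^ k * r ^ \<nu> k)"
  obtains H where "1 \<le> fps_conv_radius H"
    and "\<And>j. fps_nth H (\<nu> j) = complex_of_real (R ^ j)" "\<And>i. i \<notin> range \<nu> \<Longrightarrow> fps_nth H i = 0"
proof
  define H where "H = Abs_fps (\<lambda>i. if i \<in> range \<nu> then complex_of_real (R ^ inv \<nu> i) else 0)"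
  show 1: "fps_nth H (\<nu> j) = complex_of_real (R ^ j)" for j
    using \<nu> by (simp add: H_def strict_mono_imp_inj_on)
  show 2: "fps_nth H i = 0" if "i \<notin> range \<nu>" for i
    using that by (simp add: H_def)
  show "1 \<le> fps_conv_radius H"
    unfolding fps_conv_radius_def
  proof (rule conv_radius_geI_ex')
    fix r :: real assume r: "0 < r" "ereal r < 1"
    have "summable (\<lambda>k. complex_of_real (R ^ k * r ^ \<nu> k))"
      using summable[of r] r unfolding summable_complex_of_real by auto
    then have "summable (\<lambda>k. fps_nth H (\<nu> k) * complex_of_real r ^ \<nu> k)"
      by (simp add: 1)
    then show "summable (\<lambda>i. fps_nth H i * complex_of_real r ^ i)"
      by (subst (asm) summable_mono_reindex[OF \<nu>, where f = "\<lambda>i. fps_nth H i * complex_of_real r ^ i"])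
         (auto simp: 2)
  qed
qed

text \<open>
  A substitute for Minkowski's inequality: with \<open>T\<close> the right-hand side, each term satisfies
  \<open>x k \<le> T powr (1 / p) / 2 ^ Suc k\<close>, and these bounds add up to \<open>T powr (1 / p)\<close>.
\<close>

lemma powr_suminf_le:
  fixes x :: "nat \<Rightarrow> real"
  assumes p: "0 < p" and x: "\<And>k. 0 \<le> x k" and sum: "summable (\<lambda>k. (2 ^ Suc k * x k) powr p)"
  shows "(\<Sum>k. x k) powr p \<le> (\<Sum>k. (2 ^ Suc k * x k) powr p)"
proof -
  define T where "T = (\<Sum>k. (2 ^ Suc k * x k) powr p)"
  have T: "0 \<le> T" unfolding T_def by (intro suminf_nonneg sum) auto
  have le: "x k \<le> T powr (1 / p) * (1 / 2) ^ Suc k" for k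
  proof -
    have "(2 ^ Suc k * x k) powr p \<le> T"
      unfolding T_def using sum_le_suminf[OF sum, of "{k}"] by simp
    then have "((2 ^ Suc k * x k) powr p) powr (1 / p) \<le> T powr (1 / p)"
      using p by (intro powr_mono2) auto
    moreover have "((2 ^ Suc k * x k) powr p) powr (1 / p) = 2 ^ Suc k * x k"
      using p x[of k] by (simp add: powr_powr)
    ultimately show ?thesis by (simp add: field_simps)
  qed
  have geo: "(\<lambda>k. T powr (1 / p) * (1 / 2) ^ Suc k) sums (T powr (1 / p) * 1)"
    by (intro sums_mult power_half_series)
  have "summable x"
    by (rule summable_comparison_test'[OF sums_summable[OF geo], of 0]) (use le x in auto)
  then have "(\<Sum>k. x k) \<le> T powr (1 / p) * 1"
    unfolding sums_unique[OF geo] by (intro suminf_le le sums_summable[OF geo])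
  then have "(\<Sum>k. x k) powr p \<le> (T powr (1 / p)) powr p"
    using p \<open>summable x\<close> x by (intro powr_mono2 suminf_nonneg) auto
  also have "\<dots> = T" using p T by (simp add: powr_powr)
  finally show ?thesis unfolding T_def .
qed

section \<open>Integration against the weighted area measure and the choice of exponents\<close>

lemma space_weighted_area [simp]: "space (weighted_area \<alpha>) = unit_disk"
  by (simp add: weighted_area_def space_restrict_space)

lemma borel_measurable_weighted_area:
  "h \<in> borel_measurable borel \<Longrightarrow> h \<in> borel_measurable (weighted_area \<alpha>)"
  by (simp add: weighted_area_def measurable_restrict_space1)

lemma borel_measurable_weighted_area_continuous_on:
  "continuous_on unit_disk h \<Longrightarrow> h \<in> borel_measurable (weighted_area \<alpha>)"
  for h :: "complex \<Rightarrow> 'a::topological_space"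
proof -
  assume "continuous_on unit_disk h"
  then have "h \<in> borel_measurable (restrict_space borel unit_disk)"
    by (rule borel_measurable_continuous_on_restrict)
  also have "borel_measurable (restrict_space borel unit_disk) = borel_measurable (weighted_area \<alpha>)"
    by (rule measurable_cong_sets) (auto simp: weighted_area_def intro!: sets_restrict_space_cong)
  finally show ?thesis .
qed

text \<open>Dominated convergence with majorant \<open>norm (u z)\<close>, since
  \<open>cmod z ^ n\<close> tends to 0 at every point of the open disk. It is meant for
  \<open>u z = cmod (f z) powr p\<close>.\<close>

lemma integral_power_weight_tendsto_0:
  fixes u :: "complex \<Rightarrow> real"
  assumes u: "integrable (weighted_area \<alpha>) u"
  shows "integrable (weighted_area \<alpha>) (\<lambda>z. cmod z ^ n * u z)"
    and "(\<lambda>n. LINT z|weighted_area \<alpha>. cmod z ^ n * u z) \<longlonglongrightarrow> 0"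
proof -
  have meas: "(\<lambda>z. cmod z ^ n * u z) \<in> borel_measurable (weighted_area \<alpha>)" for n
    by (intro borel_measurable_times borel_measurable_integrable[OF u] borel_measurable_weighted_area) auto
  have le: "norm (cmod z ^ n * u z) \<le> norm (u z)" if "z \<in> unit_disk" for n z
    using that by (simp add: abs_mult mult_left_le_one_le power_le_one)
  show "integrable (weighted_area \<alpha>) (\<lambda>z. cmod z ^ n * u z)"
    using meas le by (intro Bochner_Integration.integrable_bound[OF u]) (auto intro!: AE_I2)
  have "(\<lambda>n. LINT z|weighted_area \<alpha>. cmod z ^ n * u z) \<longlonglongrightarrow> (LINT z|weighted_area \<alpha>. 0)"
  proof (rule integral_dominated_convergence[where w = "\<lambda>z. norm (u z)"])
    show "AE z in weighted_area \<alpha>. (\<lambda>n. cmod z ^ n * u z) \<longlonglongrightarrow> 0"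
      by (intro AE_I2 tendsto_mult_left_zero LIMSEQ_power_zero) auto
  qed (use u meas le in \<open>auto intro!: AE_I2\<close>)
  then show "(\<lambda>n. LINT z|weighted_area \<alpha>. cmod z ^ n * u z) \<longlonglongrightarrow> 0" by simp
qed

text \<open>Each \<open>\<nu> k\<close> is taken so large that the integral of the
  \<open>k\<close>-th term is at most \<open>(1 / 2) ^ k\<close>, hence the series can be integrated
  termwise. The bound \<open>k\<^sup>2 \<le> \<nu> k\<close> secures pointwise convergence in the
  disk.\<close>

lemma lacunary_weight_integrable:
  fixes u :: "complex \<Rightarrow> real" and C :: real
  assumes u: "integrable (weighted_area \<alpha>) u" "\<And>z. 0 \<le> u z" and C: "0 \<le> C"
  obtains \<nu> :: "nat \<Rightarrow> nat" where "strict_mono \<nu>" "\<And>k. k\<^sup>2 \<le> \<nu> k"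
    and "integrable (weighted_area \<alpha>) (\<lambda>z. (\<Sum>k. C ^ k * cmod z ^ \<nu> k) * u z)"
proof -
  let ?I = "\<lambda>n. LINT z|weighted_area \<alpha>. cmod z ^ n * u z"
  have "\<forall>k. \<exists>N. \<forall>n\<ge>N. C ^ k * ?I n < (1 / 2) ^ k"
  proof
    fix k
    have "(\<lambda>n. C ^ k * ?I n) \<longlonglongrightarrow> C ^ k * 0"
      by (intro tendsto_intros integral_power_weight_tendsto_0 u)
    then have "\<forall>\<^sub>F n in sequentially. C ^ k * ?I n < (1 / 2) ^ k"
      by (intro order_tendstoD) auto
    then show "\<exists>N. \<forall>n\<ge>N. C ^ k * ?I n < (1 / 2) ^ k"
      by (simp add: eventually_sequentially)
  qed
  then obtain N where N: "\<And>k n. N k \<le> n \<Longrightarrow> C ^ k * ?I n < (1 / 2) ^ k" by metis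
  \<comment> \<open>The square yields strict monotonicity and quadratic growth; the sum yields
    \<open>N k \<le> \<nu> k\<close> and, being nondecreasing, does not spoil monotonicity.\<close>
  define \<nu> where "\<nu> k = k\<^sup>2 + (\<Sum>j\<le>k. N j)" for k
  have mono: "strict_mono \<nu>"
    by (auto simp: strict_mono_Suc_iff \<nu>_def power2_eq_square)
  have sq: "k\<^sup>2 \<le> \<nu> k" for k by (simp add: \<nu>_def)
  have "N k \<le> \<nu> k" for k
    unfolding \<nu>_def by (intro trans_le_add2 member_le_sum) auto
  then have small: "C ^ k * ?I (\<nu> k) \<le> (1 / 2) ^ k" for k
    using N less_imp_le by blast
  have summ: "summable (\<lambda>k. C ^ k * cmod z ^ \<nu> k)" if "z \<in> unit_disk" for z
    using summable_power_times_power_square[of C "cmod z" \<nu>] C sq that by simp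
  have "integrable (weighted_area \<alpha>) (\<lambda>z. \<Sum>k. C ^ k * (cmod z ^ \<nu> k * u z))"
  proof (rule integrable_suminf)
    show "integrable (weighted_area \<alpha>) (\<lambda>z. C ^ k * (cmod z ^ \<nu> k * u z))" for k
      by (intro integrable_mult_right integral_power_weight_tendsto_0 u)
    show "AE z in weighted_area \<alpha>. summable (\<lambda>k. norm (C ^ k * (cmod z ^ \<nu> k * u z)))"
    proof (rule AE_I2)
      fix z assume "z \<in> space (weighted_area \<alpha>)"
      then have "summable (\<lambda>k. C ^ k * cmod z ^ \<nu> k * u z)"
        by (intro summable_mult2 summ) simp
      then show "summable (\<lambda>k. norm (C ^ k * (cmod z ^ \<nu> k * u z)))"
        using C u(2) by (simp add: abs_mult mult.assoc)
    qed
    have eq: "(LINT z|weighted_area \<alpha>. norm (C ^ k * (cmod z ^ \<nu> k * u z))) = C ^ k * ?I (\<nu> k)" for k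
      using C u(2) by (simp add: abs_mult)
    have "norm (C ^ k * ?I (\<nu> k)) \<le> (1 / 2) ^ k" for k
    proof -
      have "0 \<le> C ^ k * ?I (\<nu> k)"
        using C u(2) by (intro mult_nonneg_nonneg Bochner_Integration.integral_nonneg) auto
      then show ?thesis using small[of k] by simp
    qed
    moreover have "summable (\<lambda>k. (1 / 2 :: real) ^ k)"
      by (simp add: summable_geometric)
    ultimately show "summable (\<lambda>k. LINT z|weighted_area \<alpha>. norm (C ^ k * (cmod z ^ \<nu> k * u z)))"
      unfolding eq by (rule summable_comparison_test'[rotated])
  qed
  also have "?this \<longleftrightarrow> integrable (weighted_area \<alpha>) (\<lambda>z. (\<Sum>k. C ^ k * cmod z ^ \<nu> k) * u z)"
  proof (rule Bochner_Integration.integrable_cong[OF refl])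
    fix z assume "z \<in> space (weighted_area \<alpha>)"
    then show "(\<Sum>k. C ^ k * (cmod z ^ \<nu> k * u z)) = (\<Sum>k. C ^ k * cmod z ^ \<nu> k) * u z"
      by (subst suminf_mult2) (auto simp: summ mult.assoc)
  qed
  finally show thesis using that mono sq by blast
qed

section \<open>Closure properties of invariant subspaces\<close>

lemma invariant_subspaceD:
  assumes "invariant_subspace p \<alpha> M"
  shows "M \<subseteq> bergman_space p \<alpha>" "cfun.subspace M" "bergman_closed p \<alpha> M"
    and "\<And>f. f \<in> M \<Longrightarrow> shift_op f \<in> M"
  using assms by (auto simp: invariant_subspace_def)

lemma invariant_subspace_power_mult:
  assumes "invariant_subspace p \<alpha> M" "f \<in> M"
  shows "(\<lambda>z. z ^ n * f z) \<in> M"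
proof (induction n)
  case (Suc n)
  then show ?case
    using invariant_subspaceD(4)[OF assms(1) Suc] by (simp add: shift_op_def mult.assoc)
qed (simp add: assms)

lemma invariant_subspace_sum_mult:
  assumes M: "invariant_subspace p \<alpha> M" "f \<in> M"
  shows "(\<lambda>z. (\<Sum>k<N::nat. c k * z ^ \<nu> k) * f z) \<in> M"
proof (induction N)
  case 0
  show ?case using cfun.subspace_0[OF invariant_subspaceD(2)[OF M(1)]] by (simp add: zero_fun_def)
next
  case (Suc N)
  have "cscale (c N) (\<lambda>z. z ^ \<nu> N * f z) \<in> M"
    by (intro cfun.subspace_scale invariant_subspaceD(2)[OF M(1)] invariant_subspace_power_mult[OF M])
  from cfun.subspace_add[OF invariant_subspaceD(2)[OF M(1)] Suc this]
  show ?case by (simp add: cscale_def plus_fun_def algebra_simps)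
qed

text \<open>Dominated convergence upgrades the pointwise limit to a limit in the Bergman norm. The
  bound on \<open>g\<close> itself puts \<open>g\<close> into the Bergman space, which
  \<open>bergman_closed\<close> requires of a limit.\<close>

lemma bergman_dominated_limit:
  assumes p: "0 < p" and M: "bergman_closed p \<alpha> M"
    and F: "\<And>n. F n \<in> M" "M \<subseteq> bergman_space p \<alpha>" and g: "g \<in> analytic_fns"
    and lim: "\<And>z. z \<in> unit_disk \<Longrightarrow> (\<lambda>n. F n z) \<longlonglongrightarrow> g z"
    and w: "integrable (weighted_area \<alpha>) w"
    and le: "\<And>n z. z \<in> unit_disk \<Longrightarrow> cmod (F n z - g z) powr p \<le> w z"
      "\<And>z. z \<in> unit_disk \<Longrightarrow> cmod (g z) powr p \<le> w z"
  shows "g \<in> M"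
proof -
  have cont: "continuous_on unit_disk h" if "h \<in> analytic_fns" for h
    using that by (simp add: analytic_fns_def holomorphic_on_imp_continuous_on)
  have Fan: "F n \<in> analytic_fns" for n
    using F by (auto simp: bergman_space_def)
  have meas: "(\<lambda>z. cmod (h z) powr p) \<in> borel_measurable (weighted_area \<alpha>)"
    if "continuous_on unit_disk h" for h :: "complex \<Rightarrow> complex"
    using p by (intro borel_measurable_weighted_area_continuous_on continuous_on_powr'
        continuous_intros that) auto
  have "integrable (weighted_area \<alpha>) (\<lambda>z. cmod (g z) powr p)"
    using le(2) abs_ge_self order_trans
    by (intro Bochner_Integration.integrable_bound[OF w meas[OF cont[OF g]]] AE_I2) force
  then have gA: "g \<in> bergman_space p \<alpha>"
    using g by (simp add: bergman_space_def)
  have "(\<lambda>n. LINT z|weighted_area \<alpha>. cmod ((F n - g) z) powr p)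
          \<longlonglongrightarrow> (LINT z|weighted_area \<alpha>. 0)"
  proof (rule integral_dominated_convergence[OF _ _ w])
    show "(\<lambda>z. cmod ((F n - g) z) powr p) \<in> borel_measurable (weighted_area \<alpha>)" for n
      using meas[OF continuous_on_diff[OF cont[OF Fan[of n]] cont[OF g]]] by (simp add: fun_diff_def)
    show "AE z in weighted_area \<alpha>. (\<lambda>n. cmod ((F n - g) z) powr p) \<longlonglongrightarrow> 0"
    proof (rule AE_I2)
      fix z assume "z \<in> space (weighted_area \<alpha>)"
      then have "(\<lambda>n. cmod (F n z - g z)) \<longlonglongrightarrow> 0"
        using lim[of z] by (simp add: LIM_zero tendsto_norm_zero)
      then show "(\<lambda>n. cmod ((F n - g) z) powr p) \<longlonglongrightarrow> 0"
        using p by (intro tendsto_zero_powrI[where b = p]) auto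
    qed
  qed (use le in \<open>auto intro!: AE_I2\<close>)
  then have "(\<lambda>n. bergman_norm p \<alpha> (F n - g)) \<longlonglongrightarrow> 0"
    unfolding bergman_norm_def using p
    by (intro tendsto_zero_powrI[where b = "1 / p"] always_eventually allI
        Bochner_Integration.integral_nonneg) auto
  then show ?thesis
    using M F(1) gA unfolding bergman_closed_def by blast
qed

section \<open>The lacunary multiple of \<open>f\<close>, inside \<open>M\<close> but outside the
  Hardy space\<close>

theorem theorem2:
  fixes p \<alpha> :: real and M :: "(complex \<Rightarrow> complex) set"
  assumes "1 \<le> p" and "-1 < \<alpha>"
    and "invariant_subspace p \<alpha> M" and "M \<noteq> {0}"
  shows "M \<inter> (bergman_space p \<alpha> - hardy_space p) \<noteq> {}"
proof
  assume "M \<inter> (bergman_space p \<alpha> - hardy_space p) = {}"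
  note M = \<open>invariant_subspace p \<alpha> M\<close> and p = \<open>1 \<le> p\<close>
  have sub: "M \<subseteq> bergman_space p \<alpha>" by (rule invariant_subspaceD(1)[OF M])
  \<comment> \<open>This inclusion is used twice: for \<open>f\<close>, to bound its coefficients,
    and for \<open>g\<close>, to reach the contradiction.\<close>
  with \<open>M \<inter> _ = {}\<close> have hardy: "M \<subseteq> hardy_space p" by blast
  have "0 \<in> M" by (rule cfun.subspace_0[OF invariant_subspaceD(2)[OF M]])
  with \<open>M \<noteq> {0}\<close> obtain f where f: "f \<in> M" "f \<noteq> 0" by blast
  then have fA: "f \<in> bergman_space p \<alpha>" and fan: "f \<in> analytic_fns"
    using sub by (auto simp: bergman_space_def)
  have hol: "f holomorphic_on unit_disk" and f0: "\<And>z. z \<notin> unit_disk \<Longrightarrow> f z = 0"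
    using fan by (auto simp: analytic_fns_def)

  define F where "F = fps_expansion f 0"
  have F: "f has_fps_expansion F"
    unfolding F_def by (rule has_fps_expansion_fps_expansion[OF _ _ hol]) auto
  have "F \<noteq> 0"
  proof
    assume "F = 0"
    then have "(deriv ^^ n) f 0 = 0" for n
      using fps_nth_fps_expansion[OF F, of n] by simp
    then have "f z = 0" if "z \<in> unit_disk" for z
      by (rule holomorphic_fun_eq_0_on_ball[OF hol that])
    \<comment> \<open>Off the disk \<open>f\<close> vanishes by the encoding, so vanishing on the
      disk makes \<open>f\<close> the zero function.\<close>
    with f0 \<open>f \<noteq> 0\<close> show False by (auto simp: fun_eq_iff)
  qed
  define m where "m = subdegree F"
  define a where "a = cmod (fps_nth F m)"
  have a: "0 < a" and low: "\<And>l. l < m \<Longrightarrow> fps_nth F l = 0"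
    using \<open>F \<noteq> 0\<close> by (auto simp: a_def m_def)
  obtain B where B: "\<And>n. cmod (fps_nth F n) \<le> B"
    using hardy_space_coeff_bounded[OF p _ F] f hardy by blast
  \<comment> \<open>Chosen so that \<open>B / (R - 1) = a / 2\<close>: the earlier terms cancel at
    most half of the main term \<open>R ^ k * a\<close>.\<close>
  define R where "R = 1 + 2 * B / a"
  have "0 < B" using a B[of m] unfolding a_def by linarith
  then have R: "1 < R" "B / (R - 1) = a / 2"
    using a by (auto simp: R_def)

  \<comment> \<open>The factor 2 absorbs the weights \<open>2 ^ Suc k\<close> of
    \<open>powr_suminf_le\<close>, up to the single factor \<open>2 powr p\<close> that reappears in
    \<open>W\<close>.\<close>
  define C where "C = (2 * R) powr p"
  have "integrable (weighted_area \<alpha>) (\<lambda>z. cmod (f z) powr p)"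
    using fA by (simp add: bergman_space_def)
  then obtain \<nu> :: "nat \<Rightarrow> nat" where \<nu>: "strict_mono \<nu>" "\<And>k. k\<^sup>2 \<le> \<nu> k"
    and int: "integrable (weighted_area \<alpha>) (\<lambda>z. (\<Sum>k. C ^ k * cmod z ^ \<nu> k) * cmod (f z) powr p)"
    using lacunary_weight_integrable[of \<alpha> "\<lambda>z. cmod (f z) powr p" C] by (auto simp: C_def)
  have summR: "summable (\<lambda>k. R ^ k * r ^ \<nu> k)" if "0 \<le> r" "r < 1" for r :: real
    using summable_power_times_power_square[of R r \<nu>] R \<nu>(2) that by simp
  obtain H where H: "1 \<le> fps_conv_radius H"
    "\<And>j. fps_nth H (\<nu> j) = complex_of_real (R ^ j)" "\<And>i. i \<notin> range \<nu> \<Longrightarrow> fps_nth H i = 0"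
    using lacunary_series[OF \<nu>(1) summR] by blast
  have H_conv: "ereal (cmod z) < fps_conv_radius H" if "z \<in> unit_disk" for z
    using that by (intro less_le_trans[OF _ H(1)]) auto
  have H_sums: "(\<lambda>k. of_real (R ^ k) * z ^ \<nu> k) sums eval_fps H z" if "z \<in> unit_disk" for z
    using sums_eval_fps[OF H_conv[OF that]]
    by (subst (asm) sums_mono_reindex[OF \<nu>(1), symmetric]) (auto simp: H)

  define g where "g z = eval_fps H z * f z" for z
  have gan: "g \<in> analytic_fns"
    unfolding analytic_fns_def g_def using f0 H_conv
    by (auto intro!: holomorphic_intros hol simp: in_eball_iff)
  define W where "W z = 2 powr p * ((\<Sum>k. C ^ k * cmod z ^ \<nu> k) * cmod (f z) powr p)" for z
  \<comment> \<open>The parameter \<open>s\<close> stands both for \<open>eval_fps H z\<close> and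
    for a partial sum minus it, so one majorant covers \<open>g\<close> and all differences from
    \<open>g\<close>.\<close>
  have W: "(cmod s * cmod (f z)) powr p \<le> W z"
    if z: "z \<in> unit_disk" and s: "cmod s \<le> (\<Sum>k. R ^ k * cmod z ^ \<nu> k)" for s z
  proof -
    have summC: "summable (\<lambda>k. C ^ k * cmod z ^ \<nu> k)"
      using summable_power_times_power_square[of C "cmod z" \<nu>] \<nu>(2) z by (simp add: C_def)
    have le: "(2 ^ Suc k * (R ^ k * cmod z ^ \<nu> k)) powr p \<le> 2 powr p * (C ^ k * cmod z ^ \<nu> k)" for k
    proof -
      have "(2 ^ Suc k * (R ^ k * cmod z ^ \<nu> k)) powr p
              = 2 powr p * ((2 * R) ^ k) powr p * (cmod z ^ \<nu> k) powr p"
        using R by (simp add: powr_mult power_mult_distrib mult_ac)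
      also have "((2 * R) ^ k) powr p = C ^ k"
        using R powr_realpow[of "2 * R" k] powr_realpow[of C k]
        by (metis C_def mult.commute mult_pos_pos powr_gt_zero powr_powr zero_less_numeral
            zero_less_one less_trans less_irrefl)
      \<comment> \<open>For a base in the unit interval and \<open>1 \<le> p\<close>, dropping the
        exponent only enlarges the value; this leads to the series whose integrability is known from
        \<open>int\<close>.\<close>
      also have "(cmod z ^ \<nu> k) powr p \<le> cmod z ^ \<nu> k"
        using z p powr_mono'[of 1 p "cmod z ^ \<nu> k"] by (simp add: power_le_one)
      finally show ?thesis by (simp add: C_def mult_left_mono mult.assoc)
    qed
    have summ: "summable (\<lambda>k. (2 ^ Suc k * (R ^ k * cmod z ^ \<nu> k)) powr p)"
      by (rule summable_comparison_test'[OF summable_mult[OF summC], of 0 _ "2 powr p"]) (use le in simp)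
    have "cmod s powr p \<le> (\<Sum>k. R ^ k * cmod z ^ \<nu> k) powr p"
      using s p by (intro powr_mono2) auto
    also have "\<dots> \<le> (\<Sum>k. (2 ^ Suc k * (R ^ k * cmod z ^ \<nu> k)) powr p)"
      using p R by (intro powr_suminf_le summ) auto
    also have "\<dots> \<le> (\<Sum>k. 2 powr p * (C ^ k * cmod z ^ \<nu> k))"
      by (intro suminf_le le summ summable_mult summC)
    also have "\<dots> = 2 powr p * (\<Sum>k. C ^ k * cmod z ^ \<nu> k)"
      by (rule suminf_mult[OF summC])
    finally show ?thesis
      unfolding W_def by (simp add: powr_mult mult_right_mono flip: mult.assoc)
  qed
  have "g \<in> M"
  proof (rule bergman_dominated_limit[OF _ invariant_subspaceD(3)[OF M]
        invariant_subspace_sum_mult[OF M f(1)] sub gan])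
    show "integrable (weighted_area \<alpha>) W"
      unfolding W_def by (intro integrable_mult_right int)
    fix z :: complex assume z: "z \<in> unit_disk"
    let ?t = "\<lambda>k. complex_of_real (R ^ k) * z ^ \<nu> k"
    have norm_t: "cmod (?t k) = R ^ k * cmod z ^ \<nu> k" for k
      using R by (simp add: norm_mult norm_power)
    have sn: "summable (\<lambda>k. cmod (?t k))"
      unfolding norm_t using summR[of "cmod z"] z by simp
    show "(\<lambda>n. (\<Sum>k<n. ?t k) * f z) \<longlonglongrightarrow> g z"
      unfolding g_def by (intro tendsto_intros H_sums[OF z, unfolded sums_def])
    have "cmod (eval_fps H z) \<le> (\<Sum>k. R ^ k * cmod z ^ \<nu> k)"
      using summable_norm[OF sn] unfolding norm_t by (simp add: sums_unique[OF H_sums[OF z]])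
    then show "cmod (g z) powr p \<le> W z"
      using W[OF z] by (simp add: g_def norm_mult)
    fix n
    \<comment> \<open>The difference is a tail of the series, hence bounded by the full series of
      absolute values, independently of \<open>n\<close>.\<close>
    have "eval_fps H z - (\<Sum>k<n. ?t k) = (\<Sum>k. ?t (k + n))"
      using suminf_minus_initial_segment[OF sums_summable[OF H_sums[OF z]], of n]
      by (simp add: sums_unique[OF H_sums[OF z]])
    then have "cmod ((\<Sum>k<n. ?t k) - eval_fps H z) = cmod (\<Sum>k. ?t (k + n))"
      by (metis norm_minus_commute)
    also have "\<dots> \<le> (\<Sum>k. cmod (?t (k + n)))"
      by (intro summable_norm summable_ignore_initial_segment[OF sn])
    also have "\<dots> \<le> (\<Sum>k. cmod (?t k))"
      using suminf_minus_initial_segment[OF sn, of n] sum_nonneg[of "{..<n}" "\<lambda>k. cmod (?t k)"] by simp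
    finally have "cmod ((\<Sum>k<n. ?t k) - eval_fps H z) \<le> (\<Sum>k. R ^ k * cmod z ^ \<nu> k)"
      unfolding norm_t .
    from W[OF z this] show "cmod ((\<Sum>k<n. ?t k) * f z - g z) powr p \<le> W z"
      by (simp add: g_def norm_mult flip: left_diff_distrib)
  qed (use p in auto)

  have "g has_fps_expansion H * F"
    unfolding g_def
    by (intro has_fps_expansion_mult F eval_fps_has_fps_expansion less_le_trans[OF _ H(1)]) simp
  then obtain K where K: "\<And>n. cmod (fps_nth (H * F) n) \<le> K"
    using hardy_space_coeff_bounded[OF p] \<open>g \<in> M\<close> hardy by blast
  \<comment> \<open>The coefficient of \<open>H * F\<close> at \<open>\<nu> k + m\<close> is at
    least \<open>R ^ k * (a - a / 2)\<close>, while membership of \<open>g\<close> in the Hardy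
    space bounds it by \<open>K\<close>.\<close>
  have "R ^ k * (a / 2) \<le> K" for k
    using lacunary_product_coeff_ge[of m F B \<nu> R H k, OF low B \<nu>(1) R(1) H(2,3)] K[of "\<nu> k + m"] R(2)
    by (simp add: a_def)
  moreover obtain k where "2 * K / a < R ^ k"
    using real_arch_pow[OF R(1)] by blast
  ultimately show False
    using a by (simp add: field_simps not_le[symmetric])
qed

end
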